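(* Let $d\in\mathbb N$, $a\in\mathbb N_0$. The generalized Stirling numbers of the second kind satisfy $S2(d,a;0,0)=1$ and, for all $n\ge 1$ and $m=0,1,\dots,n$, $$S2(d,a;n,m)=d\,S2(d,a;n-1,m-1)+(a+d\,m)\,S2(d,a;n-1,m).$$
   Context: $\mathbb N=\{1,2,\dots\}$, $\mathbb N_0=\{0,1,2,\dots\}$. The numbers $S2(d,a;n,m)$, $0\le m\le n$, are defined by the operator identity $(a\,\mathbf 1+d\,\mathbf E_x)^n=\sum_{m=0}^n S2(d,a;n,m)\,x^m\,\mathbf d_x^{\,m}$, where $\mathbf d_x$ is differentiation with respect to $x$, $\mathbf E_x:=x\,\mathbf d_x$ and $\mathbf 1$ is the identity operator. By convention $S2(d,a;n,-1)=0$ and $S2(d,a;n,m)=0$ for $n<m$. *)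

theory Defs
  imports "HOL-Analysis.Analysis"
begin

definition smooth_fun :: "(real \<Rightarrow> real) \<Rightarrow> bool" where
  "smooth_fun f \<longleftrightarrow> (\<forall>k x. (deriv ^^ k) f field_differentiable at x)"

definition euler_op :: "(real \<Rightarrow> real) \<Rightarrow> real \<Rightarrow> real" where
  "euler_op f = (\<lambda>x. x * deriv f x)"

definition affine_euler_op :: "nat \<Rightarrow> nat \<Rightarrow> (real \<Rightarrow> real) \<Rightarrow> real \<Rightarrow> real" where
  "affine_euler_op d a f = (\<lambda>x. real a * f x + real d * euler_op f x)"

text \<open>Both sides of the operator identity act on the smooth real functions. The requirement that
  \<open>c\<close> vanish beyond \<open>n\<close> only fixes the values which the identity does not mention.\<close>

definition S2_identity :: "nat \<Rightarrow> nat \<Rightarrow> nat \<Rightarrow> (nat \<Rightarrow> real) \<Rightarrow> bool" where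
  "S2_identity d a n c \<longleftrightarrow>
     (\<forall>f. smooth_fun f \<longrightarrow>
        (affine_euler_op d a ^^ n) f = (\<lambda>x. \<Sum>m=0..n. c m * (x ^ m * (deriv ^^ m) f x))) \<and>
     (\<forall>m>n. c m = 0)"

text \<open>The lower index is an integer, to accommodate the convention for \<open>m = -1\<close>.\<close>

definition S2 :: "nat \<Rightarrow> nat \<Rightarrow> nat \<Rightarrow> int \<Rightarrow> real" where
  "S2 d a n m =
     (if 0 \<le> m \<and> m \<le> int n then (THE c. S2_identity d a n c) (nat m) else 0)"

end

(* Applying a 1 + d E_x to the normal form of order n and using x d_x (x^m d_x^m) = m x^m d_x^m + x^(m+1) d_x^(m+1)
   gives a normal form of order n + 1 whose coefficients obey the recurrence. The coefficients are unique because
   testing on (x - 1)^k at x = 1 isolates the k-th one. *)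

theory Submission
  imports Defs
begin

lemma smooth_fun_has_field_derivative:
  assumes "smooth_fun f"
  shows "((deriv ^^ k) f has_field_derivative (deriv ^^ Suc k) f x) (at x)"
  using assms by (simp add: smooth_fun_def field_differentiable_derivI)

text \<open>The product is the falling factorial of \<open>k\<close>. Truncated subtraction keeps
  the formula valid for \<open>m > k\<close>: the factor at \<open>i = k\<close> is then
  zero.\<close>

lemma higher_deriv_shifted_power:
  "(deriv ^^ m) (\<lambda>x::real. (x - z) ^ k) = (\<lambda>x. (\<Prod>i<m. real (k - i)) * (x - z) ^ (k - m))"
proof (induction m)
  case 0
  then show ?case by simp
next
  case (Suc m)
  have "((\<lambda>x. (\<Prod>i<m. real (k - i)) * (x - z) ^ (k - m)) has_field_derivative
      (\<Prod>i<Suc m. real (k - i)) * (x - z) ^ (k - Suc m)) (at x)" for x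
    by (auto intro!: derivative_eq_intros)
  then show ?case
    by (auto simp: Suc.IH DERIV_imp_deriv)
qed

lemma smooth_fun_shifted_power: "smooth_fun (\<lambda>x. (x - z) ^ k)"
  unfolding smooth_fun_def higher_deriv_shifted_power
  by (intro allI derivative_intros)

text \<open>The test point is 1 because every weight \<open>x ^ m\<close> equals 1 there, whereas at
  0 all terms with \<open>m > 0\<close> would be lost. The left side does not mention
  \<open>c\<close>, so it determines \<open>c k\<close>.\<close>

lemma S2_identity_coeff:
  assumes "S2_identity d a n c" and "k \<le> n"
  shows "(affine_euler_op d a ^^ n) (\<lambda>x. (x - 1) ^ k) 1 = c k * (\<Prod>i<k. real (k - i))"
proof -
  have "(affine_euler_op d a ^^ n) (\<lambda>x. (x - 1) ^ k) 1
      = (\<Sum>m=0..n. c m * (1 ^ m * (deriv ^^ m) (\<lambda>x. (x - 1) ^ k) 1))"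
    using assms(1) smooth_fun_shifted_power unfolding S2_identity_def by simp
  also have "\<dots> = (\<Sum>m=0..n. if m = k then c k * (\<Prod>i<k. real (k - i)) else 0)"
  proof (intro sum.cong refl)
    fix m
    have "(\<Prod>i<m. real (k - i)) = 0" if "k < m"
      using that by (auto intro!: prod_zero)
    \<comment> \<open>For \<open>m < k\<close> a positive power of \<open>1 - 1\<close> remains; for
      \<open>m > k\<close> the falling factorial vanishes.\<close>
    then show "c m * (1 ^ m * (deriv ^^ m) (\<lambda>x. (x - 1) ^ k) 1) =
        (if m = k then c k * (\<Prod>i<k. real (k - i)) else 0)"
      by (cases m k rule: linorder_cases) (auto simp: higher_deriv_shifted_power)
  qed
  finally show ?thesis
    using assms(2) by simp
qed

lemma S2_identity_unique:
  assumes "S2_identity d a n c" and "S2_identity d a n c'"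
  shows "c = c'"
proof
  fix k
  show "c k = c' k"
  proof (cases "k \<le> n")
    case True
    then have "c k * (\<Prod>i<k. real (k - i)) = c' k * (\<Prod>i<k. real (k - i))"
      using S2_identity_coeff[OF assms(1)] S2_identity_coeff[OF assms(2)] by simp
    \<comment> \<open>This product is \<open>k!\<close>.\<close>
    moreover have "(\<Prod>i<k. real (k - i)) \<noteq> 0"
      by simp
    ultimately show ?thesis
      by (simp only: mult_cancel_right) simp
  next
    case False
    then show ?thesis
      using assms unfolding S2_identity_def by simp
  qed
qed

lemma S2_identity_0: "S2_identity d a 0 (\<lambda>m. if m = 0 then 1 else 0)"
  unfolding S2_identity_def by simp

lemma S2_identity_Suc:
  assumes "S2_identity d a n c"
  shows "S2_identity d a (Suc n)
    (\<lambda>m. real d * (if m = 0 then 0 else c (m - 1)) + (real a + real d * real m) * c m)"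
proof -
  \<comment> \<open>Used twice: to extend a sum from \<open>n\<close> to \<open>Suc n\<close>, and
    to see that the new coefficients vanish beyond \<open>Suc n\<close>.\<close>
  have zero: "c m = 0" if "m > n" for m
    using assms that unfolding S2_identity_def by simp
  have "(affine_euler_op d a ^^ Suc n) f x
      = (\<Sum>m=0..Suc n. (real d * (if m = 0 then 0 else c (m - 1)) + (real a + real d * real m) * c m)
           * (x ^ m * (deriv ^^ m) f x))" (is "_ = ?rhs")
    if f: "smooth_fun f" for f x
  proof -
    let ?g = "\<lambda>m x. x ^ m * (deriv ^^ m) f x"
    have op: "(affine_euler_op d a ^^ n) f = (\<lambda>x. \<Sum>m=0..n. c m * ?g m x)"
      using assms f unfolding S2_identity_def by simp
    have "((\<lambda>x. \<Sum>m=0..n. c m * ?g m x) has_field_derivative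
        (\<Sum>m=0..n. c m * (real m * x ^ (m - 1) * (deriv ^^ m) f x + x ^ m * (deriv ^^ Suc m) f x))) (at x)"
      by (rule DERIV_sum)
        (auto intro!: derivative_eq_intros smooth_fun_has_field_derivative[OF f, simplified])
    then have "x * deriv (\<lambda>x. \<Sum>m=0..n. c m * ?g m x) x
        = (\<Sum>m=0..n. x * (c m * (real m * x ^ (m - 1) * (deriv ^^ m) f x + x ^ m * (deriv ^^ Suc m) f x)))"
      by (simp only: DERIV_imp_deriv sum_distrib_left)
    also have "\<dots> = (\<Sum>m=0..n. c m * (real m * ?g m x + ?g (Suc m) x))"
    proof (intro sum.cong refl)
      fix m
      show "x * (c m * (real m * x ^ (m - 1) * (deriv ^^ m) f x + x ^ m * (deriv ^^ Suc m) f x))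
          = c m * (real m * ?g m x + ?g (Suc m) x)"
        \<comment> \<open>At \<open>m = 0\<close> the exponent \<open>m - 1\<close> is truncated,
          but the factor \<open>real m\<close> removes that term; otherwise
          \<open>x * x ^ (m - 1) = x ^ m\<close>.\<close>
        by (cases m) (simp_all add: algebra_simps)
    qed
    finally have "(affine_euler_op d a ^^ Suc n) f x
        = real a * (\<Sum>m=0..n. c m * ?g m x)
          + real d * (\<Sum>m=0..n. c m * (real m * ?g m x + ?g (Suc m) x))"
      by (simp add: op affine_euler_op_def euler_op_def del: funpow.simps(2)
          add: funpow.simps(2)[of n "affine_euler_op d a"])
    also have "\<dots> = (\<Sum>m=0..n. real d * c m * ?g (Suc m) x)
          + (\<Sum>m=0..n. (real a + real d * real m) * c m * ?g m x)"
      unfolding sum_distrib_left sum.distrib[symmetric]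
      by (intro sum.cong refl) (simp only: algebra_simps)
    \<comment> \<open>Index shift by one; the added term at \<open>m = 0\<close> is zero, which
      mirrors the convention for the lower index -1.\<close>
    also have "(\<Sum>m=0..n. real d * c m * ?g (Suc m) x)
        = (\<Sum>m=0..Suc n. real d * (if m = 0 then 0 else c (m - 1)) * ?g m x)"
      by (simp add: sum.atLeast0_atMost_Suc_shift del: sum.cl_ivl_Suc funpow.simps)
    \<comment> \<open>The added top term contains \<open>c (Suc n) = 0\<close>.\<close>
    also have "(\<Sum>m=0..n. (real a + real d * real m) * c m * ?g m x)
        = (\<Sum>m=0..Suc n. (real a + real d * real m) * c m * ?g m x)"
      by (simp add: zero)
    finally show ?thesis
      by (simp only: sum.distrib[symmetric] distrib_right)
  qed
  then show ?thesis
    unfolding S2_identity_def using zero by (simp add: fun_eq_iff del: sum.cl_ivl_Suc funpow.simps)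
qed

lemma S2_identity_exists: "\<exists>c. S2_identity d a n c"
  by (induction n) (blast intro: S2_identity_0 S2_identity_Suc)+

text \<open>Uniqueness resolves the definite description. The upper bound in \<open>S2\<close> is
  absorbed by the vanishing of \<open>c\<close> beyond \<open>n\<close>, so only the sign test
  remains.\<close>

lemma S2_eq:
  assumes "S2_identity d a n c"
  shows "S2 d a n m = (if m < 0 then 0 else c (nat m))"
proof -
  have "(THE c. S2_identity d a n c) = c"
    using assms S2_identity_unique by blast
  moreover have "c k = 0" if "k > n" for k
    using assms that unfolding S2_identity_def by simp
  ultimately show ?thesis
    unfolding S2_def by auto
qed

theorem mainTheorem4:
  fixes d a :: nat
  assumes "d \<ge> 1"
  shows "S2 d a 0 0 = 1 \<and>
    (\<forall>n\<ge>1. \<forall>m\<in>{0..int n}.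
       S2 d a n m = real d * S2 d a (n - 1) (m - 1)
                    + (real a + real d * of_int m) * S2 d a (n - 1) m)"
proof (intro conjI allI impI ballI)
  show "S2 d a 0 0 = 1"
    by (simp add: S2_eq[OF S2_identity_0])
next
  fix n :: nat and m :: int
  assume "n \<ge> 1" and "m \<in> {0..int n}"
  then obtain k where n: "n = Suc k" and m: "0 \<le> m"
    by (cases n) auto
  obtain c where c: "S2_identity d a k c"
    using S2_identity_exists by blast
  show "S2 d a n m = real d * S2 d a (n - 1) (m - 1)
      + (real a + real d * of_int m) * S2 d a (n - 1) m"
    \<comment> \<open>At \<open>m = 0\<close> the index \<open>m - 1\<close> is negative and meets
      the zero branch of the recurrence; for \<open>m > 0\<close>,
      \<open>nat (m - 1) = nat m - 1\<close>.\<close>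
    using m by (auto simp: n S2_eq[OF c] S2_eq[OF S2_identity_Suc[OF c]] nat_diff_distrib)
qed

end
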